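(* Let $A$ be a finite alphabet, let $F$ be a one-dimensional cellular automaton on $A^{\mathbb{Z}}$, and let $\overline{F}$ be its extension to dimension 2. Then $$ER(A^{\mathbb{Z}^2},\overline{F})=2\cdot h(A^{\mathbb{Z}},F),$$ where $h(A^{\mathbb{Z}},F)$ is the topological entropy of $F$.
   Context: A one-dimensional cellular automaton of radius $r$ is a map $F:A^{\mathbb{Z}}\to A^{\mathbb{Z}}$ with $F(x)_i=f(x_{i-r},\dots,x_{i+r})$ for a block map $f:A^{2r+1}\to A$. Let $E_n=\{(i,j)\in\mathbb{Z}^2: -n\le i,j\le n\}$. The extension of $F$ to dimension 2 is the CA $\overline{F}$ on $A^{\mathbb{Z}^2}$ of radius $r$, $\overline{F}(x)_z=\overline{f}\big((x_{z+u})_{u\in E_r}\big)$, with local map $\overline{f}:A^{E_r}\to A$ given by $\overline{f}(P)=f\big(P_{(0,-r)}P_{(0,-r+1)}\cdots P_{(0,r)}\big)$. Topological entropy rate of a CA $G$ of radius $r$ on $A^{\mathbb{Z}^2}$ (product of discrete topologies, shifts $\sigma^v(x)_u=x_{u+v}$): for $n\ge r$ let $E'_n=E_n\setminus E_{n-r}$; for a finite open cover $\mathcal{C}$, $\mathcal{C}'_n=\bigvee_{v\in E'_n}\sigma^v(\mathcal{C})$. For an open cover $\mathcal{U}$, $H(\mathcal{U})=\ln N(\mathcal{U})$ with $N(\mathcal{U})$ the smallest cardinality of a subcover; $h(\mathcal{U},G)=\lim_{N}\frac1N H(\bigvee_{i=0}^{N-1}G^{-i}\mathcal{U})$; $ER(\mathcal{C},G)=\limsup_{n\to\infty}\frac1n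 h(\mathcal{C}'_n,G)$; $ER(A^{\mathbb{Z}^2},G)=\sup_{\mathcal{C}}ER(\mathcal{C},G)$ over all finite open covers. *)

theory Defs
  imports "HOL-Analysis.Analysis"
begin

text \<open>
  The phase space is a topological space given by its type. For configurations
  \<open>'i \<Rightarrow> 'a\<close> over an alphabet of class \<open>discrete_topology\<close>, \<open>open\<close> is the product of the
  discrete topologies.
\<close>

definition open_cover :: "'x::topological_space set set \<Rightarrow> bool" where
  "open_cover U \<longleftrightarrow> (\<forall>u\<in>U. open u) \<and> \<Union>U = UNIV"

text \<open>The join over an empty index set is the trivial cover \<open>{UNIV}\<close>.\<close>

definition cover_join :: "'i set \<Rightarrow> ('i \<Rightarrow> 'x set set) \<Rightarrow> 'x set set" where
  "cover_join I U = {\<Inter>i\<in>I. c i | c. \<forall>i\<in>I. c i \<in> U i}"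

text \<open>
  Finiteness is required explicitly because \<open>card\<close> is \<open>0\<close> on infinite sets; on a compact
  space every open cover has a finite subcover.
\<close>

definition cover_number :: "'x set set \<Rightarrow> nat" where
  "cover_number U = (LEAST k. \<exists>V\<subseteq>U. finite V \<and> \<Union>V = UNIV \<and> card V = k)"

definition cover_H :: "'x set set \<Rightarrow> real" where
  "cover_H U = ln (real (cover_number U))"

definition cover_entropy :: "'x set set \<Rightarrow> ('x \<Rightarrow> 'x) \<Rightarrow> real" where
  "cover_entropy U G =
     lim (\<lambda>N. cover_H (cover_join {..<N} (\<lambda>i. (\<lambda>u. (G ^^ i) -` u) ` U)) / real N)"

definition topological_entropy :: "('x::topological_space \<Rightarrow> 'x) \<Rightarrow> ereal" where
  "topological_entropy G = (SUP U\<in>{U. open_cover U}. ereal (cover_entropy U G))"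

text \<open>A word of length \<open>n\<close> is a list; a block map of radius \<open>r\<close> is only ever applied to
  lists of length \<open>2 * r + 1\<close>.\<close>

definition ca1 :: "nat \<Rightarrow> ('a list \<Rightarrow> 'a) \<Rightarrow> (int \<Rightarrow> 'a) \<Rightarrow> (int \<Rightarrow> 'a)" where
  "ca1 r f x = (\<lambda>i. f (map (\<lambda>k. x (i + k)) [- int r..int r]))"

definition E :: "nat \<Rightarrow> (int \<times> int) set" where
  "E n = {(i, j). - int n \<le> i \<and> i \<le> int n \<and> - int n \<le> j \<and> j \<le> int n}"

text \<open>A pattern on \<open>E r\<close> is a function on the plane that is \<open>undefined\<close> outside \<open>E r\<close>.\<close>

definition ca2 ::
  "nat \<Rightarrow> ((int \<times> int \<Rightarrow> 'a) \<Rightarrow> 'a) \<Rightarrow> (int \<times> int \<Rightarrow> 'a) \<Rightarrow> (int \<times> int \<Rightarrow> 'a)" where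
  "ca2 r g x = (\<lambda>z. g (restrict (\<lambda>u. x (z + u)) (E r)))"

definition extend_block_map :: "nat \<Rightarrow> ('a list \<Rightarrow> 'a) \<Rightarrow> (int \<times> int \<Rightarrow> 'a) \<Rightarrow> 'a" where
  "extend_block_map r f P = f (map (\<lambda>k. P (0, k)) [- int r..int r])"

definition ca_extension ::
  "nat \<Rightarrow> ('a list \<Rightarrow> 'a) \<Rightarrow> (int \<times> int \<Rightarrow> 'a) \<Rightarrow> (int \<times> int \<Rightarrow> 'a)" where
  "ca_extension r f = ca2 r (extend_block_map r f)"

definition shift2 :: "int \<times> int \<Rightarrow> (int \<times> int \<Rightarrow> 'a) \<Rightarrow> (int \<times> int \<Rightarrow> 'a)" where
  "shift2 v x = (\<lambda>u. x (u + v))"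

text \<open>
  Meaningful for \<open>n \<ge> r\<close> only; for smaller \<open>n\<close> the difference \<open>n - r\<close> truncates to \<open>0\<close>,
  which the limit superior below does not see.
\<close>

definition E' :: "nat \<Rightarrow> nat \<Rightarrow> (int \<times> int) set" where
  "E' r n = E n - E (n - r)"

definition frame_cover ::
  "nat \<Rightarrow> nat \<Rightarrow> (int \<times> int \<Rightarrow> 'a) set set \<Rightarrow> (int \<times> int \<Rightarrow> 'a) set set" where
  "frame_cover r n C = cover_join (E' r n) (\<lambda>v. (\<lambda>u. shift2 v ` u) ` C)"

definition cover_entropy_rate ::
  "nat \<Rightarrow> (int \<times> int \<Rightarrow> 'a) set set \<Rightarrow>
    ((int \<times> int \<Rightarrow> 'a) \<Rightarrow> (int \<times> int \<Rightarrow> 'a)) \<Rightarrow> ereal" where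
  "cover_entropy_rate r C G =
     limsup (\<lambda>n. ereal (cover_entropy (frame_cover r n C) G / real n))"

text \<open>The radius \<open>r\<close> is a parameter of the entropy rate, since it fixes the width of the frames.\<close>

definition entropy_rate ::
  "nat \<Rightarrow> ((int \<times> int \<Rightarrow> 'a::topological_space) \<Rightarrow> (int \<times> int \<Rightarrow> 'a)) \<Rightarrow> ereal" where
  "entropy_rate r G = (SUP C\<in>{C. finite C \<and> open_cover C}. cover_entropy_rate r C G)"

end

theory Submission imports Defs begin

text \<open>
  The extension runs an independent copy of \<open>F\<close> on each row \<open>{i} \<times> \<int>\<close>, so the entropy seen through
  a window \<open>I \<times> J\<close> is \<open>card I\<close> times the entropy \<open>F\<close> shows on \<open>J\<close>. By compactness every open
  cover is refined by the cylinders over some finite window, so \<open>h F\<close> is the supremum of the entropies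
  \<open>h\<^sub>k\<close> of \<open>F\<close> on \<open>[-k, k]\<close>.

  Upper bound: the frame cover of a cover with window \<open>E m\<close> is refined by the cylinders over
  \<open>E (n + m)\<close>, of entropy at most \<open>(2 (n + m) + 1) h F\<close>. Lower bound: the frame of width \<open>r\<close>
  meets each row \<open>i \<in> [-n, n]\<close> in both ends of \<open>[-n, n]\<close>, of width \<open>r\<close>. Given the initial
  values on \<open>[-n, n]\<close>, the evolution there is determined by the evolution of the ends, so each row
  contributes at least \<open>h\<^sub>n\<close>, and the frame at least \<open>(2 n + 1) h\<^sub>n\<close>.
\<close>

section \<open>Subadditive sequences\<close>

text \<open>Fekete's argument: the limit is the infimum of the quotients over \<open>n >= 1\<close>,
  which exists because they are nonnegative. Division with remainder by an \<open>m\<close> whose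
  quotient is nearly minimal bounds all later quotients.\<close>

lemma subadditive_imp_convergent:
  fixes a :: "nat \<Rightarrow> real"
  assumes sub: "\<And>m n. a (m + n) \<le> a m + a n" and nonneg: "\<And>n. 0 \<le> a n"
  shows "convergent (\<lambda>n. a n / real n)"
proof -
  have mult: "a (q * m + s) \<le> real q * a m + a s" for q m s
  proof (induction q)
    case (Suc q)
    have "a (Suc q * m + s) = a (m + (q * m + s))" by (simp add: algebra_simps)
    also have "\<dots> \<le> a m + a (q * m + s)" by (rule sub)
    finally show ?case using Suc by (simp add: algebra_simps)
  qed simp
  define L where "L = Inf ((\<lambda>n. a n / real n) ` {1..})"
  have bdd: "bdd_below ((\<lambda>n. a n / real n) ` {1..})"
    by (rule bdd_belowI[of _ 0]) (auto simp: nonneg)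
  have lower: "L \<le> a n / real n" if "n \<ge> 1" for n
    unfolding L_def using that by (intro cInf_lower bdd) auto
  have "(\<lambda>n. a n / real n) \<longlonglongrightarrow> L"
  proof (rule order_tendstoI)
    fix y assume "y < L"
    then show "\<forall>\<^sub>F n in sequentially. y < a n / real n"
      using lower by (intro eventually_sequentiallyI[of 1]) (meson less_le_trans)
  next
    fix y assume "L < y"
    then obtain m where m: "m \<ge> 1" "a m / real m < y"
      using cInf_lessD[of "(\<lambda>n. a n / real n) ` {1..}" y] unfolding L_def by auto
    \<comment> \<open>\<open>B\<close> bounds \<open>a s\<close> for all remainders
      \<open>s < m\<close> at once, so the remainder contributes at most \<open>B / n\<close>, which
      vanishes in the limit.\<close>
    define B where "B = a 0 + real m * a 1"
    have B: "a s \<le> B" if "s < m" for s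
    proof -
      have "a s \<le> real s * a 1 + a 0" using mult[of s 1 0] by simp
      also have "\<dots> \<le> B" using that nonneg[of 1] by (auto simp: B_def intro!: mult_right_mono)
      finally show ?thesis .
    qed
    have le: "a n / real n \<le> a m / real m + B / real n" if "n \<ge> 1" for n
    proof -
      have "a n \<le> real (n div m) * a m + a (n mod m)"
        using mult[of "n div m" m "n mod m"] by simp
      also have "\<dots> \<le> real (n div m) * a m + B" using B[of "n mod m"] m by simp
      also have "\<dots> \<le> (real n / real m) * a m + B"
        using mult_right_mono[OF of_nat_div_le_of_nat[of n m, where ?'a = real] nonneg[of m]]
        by simp
      finally show ?thesis using that m by (simp add: field_simps)
    qed
    have "(\<lambda>n. a m / real m + B / real n) \<longlonglongrightarrow> a m / real m + 0"
      by (intro tendsto_intros lim_const_over_n)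
    then have "\<forall>\<^sub>F n in sequentially. a m / real m + B / real n < y"
      using m by (intro order_tendstoD) auto
    then show "\<forall>\<^sub>F n in sequentially. a n / real n < y"
      using eventually_ge_at_top[of 1] by eventually_elim (use le in force)
  qed
  then show ?thesis by (rule convergentI)
qed

section \<open>Cover numbers and the entropy of a cover\<close>

text \<open>This is exactly the condition under which the \<open>LEAST\<close> in
  \<open>cover_number\<close> is attained. It mentions no topology, so the counting arguments on
  covers need neither openness nor compactness.\<close>

definition finitely_covering :: "'x set set \<Rightarrow> bool" where
  "finitely_covering U \<longleftrightarrow> (\<exists>V\<subseteq>U. finite V \<and> \<Union>V = UNIV)"

lemma open_cover_imp_finitely_covering:
  assumes "compact (UNIV :: 'x::topological_space set)" "open_cover (U :: 'x set set)"
  shows "finitely_covering U"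
  using compactE[OF assms(1), of U] assms(2) unfolding open_cover_def finitely_covering_def
  by (metis top.extremum_uniqueI subset_UNIV)

lemma cover_number_le:
  assumes "V \<subseteq> U" "finite V" "\<Union>V = UNIV"
  shows "cover_number U \<le> card V"
  unfolding cover_number_def by (rule Least_le) (use assms in auto)

lemma cover_number_witness:
  assumes "finitely_covering U"
  obtains V where "V \<subseteq> U" "finite V" "\<Union>V = UNIV" "card V = cover_number U"
proof -
  have "\<exists>k. \<exists>V\<subseteq>U. finite V \<and> \<Union>V = UNIV \<and> card V = k"
    using assms unfolding finitely_covering_def by auto
  from LeastI_ex[OF this] show ?thesis
    unfolding cover_number_def[symmetric] using that by auto
qed

lemma cover_number_pos:
  assumes "finitely_covering U"
  shows "1 \<le> cover_number U"
proof -
  obtain V where V: "V \<subseteq> U" "finite V" "\<Union>V = UNIV" "card V = cover_number U"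
    using assms by (rule cover_number_witness)
  then have "V \<noteq> {}" by auto
  then show ?thesis using V card_gt_0_iff[of V] by simp
qed

text \<open>One finite subcover is chosen per index; the intersections along the finitely many
  choice functions in \<open>PiE I V\<close> still cover.\<close>

lemma finitely_covering_cover_join:
  assumes "finite I" "\<And>i. i \<in> I \<Longrightarrow> finitely_covering (U i)"
  shows "finitely_covering (cover_join I U)"
proof -
  from assms(2) have "\<forall>i\<in>I. \<exists>V\<subseteq>U i. finite V \<and> \<Union>V = UNIV"
    unfolding finitely_covering_def by blast
  then obtain V where V: "\<And>i. i \<in> I \<Longrightarrow> V i \<subseteq> U i \<and> finite (V i) \<and> \<Union>(V i) = UNIV"
    by metis
  let ?J = "(\<lambda>c. \<Inter>i\<in>I. c i) ` PiE I V"
  have "?J \<subseteq> cover_join I U"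
  proof (rule image_subsetI)
    fix c assume "c \<in> PiE I V"
    then have "\<forall>i\<in>I. c i \<in> U i" using V by (meson PiE_mem subsetD)
    then show "(\<Inter>i\<in>I. c i) \<in> cover_join I U" unfolding cover_join_def by blast
  qed
  moreover have "finite ?J"
    using assms(1) V by (intro finite_imageI finite_PiE) auto
  moreover have "x \<in> \<Union>?J" for x
  proof -
    have "\<forall>i\<in>I. \<exists>v\<in>V i. x \<in> v" using V by blast
    then obtain c where c: "\<forall>i\<in>I. c i \<in> V i \<and> x \<in> c i" by metis
    then have "restrict c I \<in> PiE I V" "x \<in> (\<Inter>i\<in>I. restrict c I i)" by auto
    then show ?thesis by blast
  qed
  ultimately show ?thesis unfolding finitely_covering_def by (metis UNIV_eq_I)
qed

lemma finitely_covering_vimage: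
  assumes "finitely_covering U"
  shows "finitely_covering ((\<lambda>u. g -` u) ` U)"
proof -
  obtain V where "V \<subseteq> U" "finite V" "\<Union>V = UNIV"
    using assms unfolding finitely_covering_def by auto
  then show ?thesis unfolding finitely_covering_def
    by (intro exI[of _ "(\<lambda>u. g -` u) ` V"]) (auto simp: set_eq_iff)
qed

lemma finitely_covering_image:
  assumes "finitely_covering U" "surj g"
  shows "finitely_covering ((\<lambda>u. g ` u) ` U)"
proof -
  obtain V where "V \<subseteq> U" "finite V" "\<Union>V = UNIV"
    using assms unfolding finitely_covering_def by auto
  moreover from this have "\<Union>((\<lambda>u. g ` u) ` V) = UNIV"
    using assms(2) by (metis image_Union)
  ultimately show ?thesis unfolding finitely_covering_def
    by (intro exI[of _ "(\<lambda>u. g ` u) ` V"]) auto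
qed

definition iterate_join :: "'x set set \<Rightarrow> ('x \<Rightarrow> 'x) \<Rightarrow> nat \<Rightarrow> 'x set set" where
  "iterate_join U G N = cover_join {..<N} (\<lambda>i. (\<lambda>u. (G ^^ i) -` u) ` U)"

lemma in_iterate_joinI:
  assumes "\<And>i. i < N \<Longrightarrow> u i \<in> U" "w = {x. \<forall>i<N. (G ^^ i) x \<in> u i}"
  shows "w \<in> iterate_join U G N"
  unfolding iterate_join_def cover_join_def using assms
  by (auto intro!: exI[of _ "\<lambda>i. (G ^^ i) -` u i"])

lemma in_iterate_joinE:
  assumes "w \<in> iterate_join U G N"
  obtains u where "\<And>i. i < N \<Longrightarrow> u i \<in> U" "w = {x. \<forall>i<N. (G ^^ i) x \<in> u i}"
proof -
  from assms obtain c where c: "w = (\<Inter>i\<in>{..<N}. c i)" "\<forall>i<N. c i \<in> (\<lambda>u. (G ^^ i) -` u) ` U"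
    unfolding iterate_join_def cover_join_def by auto
  then have "\<forall>i. \<exists>u. i < N \<longrightarrow> u \<in> U \<and> c i = (G ^^ i) -` u" by blast
  then obtain u where u: "\<forall>i<N. u i \<in> U \<and> c i = (G ^^ i) -` u i"
    using choice[of "\<lambda>i u. i < N \<longrightarrow> u \<in> U \<and> c i = (G ^^ i) -` u"] by blast
  have "w = {x. \<forall>i<N. (G ^^ i) x \<in> u i}" unfolding c(1) using u by auto
  with u show ?thesis using that by blast
qed

lemma finitely_covering_iterate_join:
  "finitely_covering U \<Longrightarrow> finitely_covering (iterate_join U G N)"
  unfolding iterate_join_def
  by (intro finitely_covering_cover_join finitely_covering_vimage) auto

text \<open>Itineraries concatenate: \<open>v\<close> prescribes the first \<open>M\<close> times
  and \<open>w\<close>, pulled back along \<open>G ^^ M\<close>, the next \<open>N\<close>.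
  Submultiplicativity of the cover numbers follows.\<close>

lemma iterate_join_add:
  assumes "v \<in> iterate_join U G M" "w \<in> iterate_join U G N"
  shows "v \<inter> (G ^^ M) -` w \<in> iterate_join U G (M + N)"
proof -
  obtain a where a: "\<And>i. i < M \<Longrightarrow> a i \<in> U" "v = {x. \<forall>i<M. (G ^^ i) x \<in> a i}"
    using assms(1) by (rule in_iterate_joinE) blast
  obtain b where b: "\<And>i. i < N \<Longrightarrow> b i \<in> U" "w = {x. \<forall>i<N. (G ^^ i) x \<in> b i}"
    using assms(2) by (rule in_iterate_joinE) blast
  let ?u = "\<lambda>i. if i < M then a i else b (i - M)"
  have "(\<forall>i<M + N. (G ^^ i) x \<in> ?u i) \<longleftrightarrow> x \<in> v \<inter> (G ^^ M) -` w" for x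
  proof
    assume L: "\<forall>i<M + N. (G ^^ i) x \<in> ?u i"
    have "(G ^^ i) x \<in> a i" if "i < M" for i
      using L that by (auto dest: spec[of _ i])
    moreover have "(G ^^ i) ((G ^^ M) x) \<in> b i" if "i < N" for i
      using L[rule_format, of "i + M"] that by (simp add: funpow_add)
    ultimately show "x \<in> v \<inter> (G ^^ M) -` w" by (simp add: a b)
  next
    assume R: "x \<in> v \<inter> (G ^^ M) -` w"
    show "\<forall>i<M + N. (G ^^ i) x \<in> ?u i"
    proof (intro allI impI)
      fix i assume i: "i < M + N"
      show "(G ^^ i) x \<in> ?u i"
      proof (cases "i < M")
        case True
        then show ?thesis using R by (simp add: a)
      next
        case False
        then have "(G ^^ i) x = (G ^^ (i - M)) ((G ^^ M) x)"
          by (metis comp_apply funpow_add le_add_diff_inverse2 not_less)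
        moreover have "(G ^^ (i - M)) ((G ^^ M) x) \<in> b (i - M)"
          using R False i by (simp add: b)
        ultimately show ?thesis using False by simp
      qed
    qed
  qed
  then show ?thesis
    by (intro in_iterate_joinI[of _ ?u]) (use a b in \<open>auto simp: set_eq_iff\<close>)
qed

lemma cover_number_iterate_join_add:
  assumes "finitely_covering U"
  shows "cover_number (iterate_join U G (M + N))
    \<le> cover_number (iterate_join U G M) * cover_number (iterate_join U G N)"
proof -
  obtain V where V: "V \<subseteq> iterate_join U G M" "finite V" "\<Union>V = UNIV"
      "card V = cover_number (iterate_join U G M)"
    by (rule cover_number_witness[OF finitely_covering_iterate_join[OF assms]])
  obtain W where W: "W \<subseteq> iterate_join U G N" "finite W" "\<Union>W = UNIV"
      "card W = cover_number (iterate_join U G N)"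
    by (rule cover_number_witness[OF finitely_covering_iterate_join[OF assms]])
  let ?Z = "(\<lambda>(v, w). v \<inter> (G ^^ M) -` w) ` (V \<times> W)"
  have "x \<in> \<Union>?Z" for x
  proof -
    obtain v w where "v \<in> V" "x \<in> v" "w \<in> W" "(G ^^ M) x \<in> w"
      using V(3) W(3) by (metis UNIV_I UnionE)
    then show ?thesis by auto
  qed
  then have "\<Union>?Z = UNIV" by blast
  moreover have "?Z \<subseteq> iterate_join U G (M + N)"
    using V(1) W(1) by (auto intro!: iterate_join_add)
  ultimately have "cover_number (iterate_join U G (M + N)) \<le> card ?Z"
    using V(2) W(2) by (intro cover_number_le) auto
  also have "\<dots> \<le> card (V \<times> W)" using V(2) W(2) by (intro card_image_le) auto
  finally show ?thesis by (simp add: card_cartesian_product V(4) W(4))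
qed

text \<open>\<open>cover_entropy\<close> is defined by \<open>lim\<close>, which says nothing until
  convergence is known. Logarithms of submultiplicative numbers that are at least 1 are subadditive
  and nonnegative, so Fekete's argument applies.\<close>

lemma cover_entropy_tendsto:
  assumes "finitely_covering U"
  shows "(\<lambda>N. ln (real (cover_number (iterate_join U G N))) / real N) \<longlonglongrightarrow> cover_entropy U G"
proof -
  note pos = cover_number_pos[OF finitely_covering_iterate_join[OF assms, of G]]
  have "convergent (\<lambda>N. ln (real (cover_number (iterate_join U G N))) / real N)"
  proof (rule subadditive_imp_convergent)
    fix M N
    let ?c = "\<lambda>N. cover_number (iterate_join U G N)"
    have "ln (real (?c (M + N))) \<le> ln (real (?c M * ?c N))"
      using cover_number_iterate_join_add[OF assms, of G M N] pos[of "M + N"]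
      by (intro ln_mono) (auto simp flip: of_nat_mult)
    also have "\<dots> = ln (real (?c M)) + ln (real (?c N))"
      using pos[of M] pos[of N] by (simp add: ln_mult)
    finally show "ln (real (?c (M + N))) \<le> ln (real (?c M)) + ln (real (?c N))" .
  qed (use pos in auto)
  then show ?thesis
    unfolding cover_entropy_def cover_H_def iterate_join_def[symmetric]
    by (simp add: convergent_LIMSEQ_iff)
qed

section \<open>Counting space-time words\<close>

text \<open>These are the histories of length \<open>N\<close> seen through the window
  \<open>K\<close>. Restriction to the space-time box makes equality of words mean agreement inside
  the box, and makes the set finite for finite \<open>K\<close> over a finite alphabet.\<close>

definition words :: "(('i \<Rightarrow> 'a) \<Rightarrow> ('i \<Rightarrow> 'a)) \<Rightarrow> 'i set \<Rightarrow> nat \<Rightarrow> (nat \<times> 'i \<Rightarrow> 'a) set" where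
  "words G K N = range (\<lambda>x. restrict (\<lambda>(t, z). (G ^^ t) x z) ({..<N} \<times> K))"

lemma word_eq_iff:
  "restrict (\<lambda>(t, z). (G ^^ t) x z) ({..<N} \<times> K) = restrict (\<lambda>(t, z). (G ^^ t) y z) ({..<N} \<times> K)
    \<longleftrightarrow> (\<forall>t<N. \<forall>z\<in>K. (G ^^ t) x z = (G ^^ t) y z)"
  by (auto simp: fun_eq_iff restrict_def)

lemma finite_words:
  fixes G :: "('i \<Rightarrow> 'a::finite) \<Rightarrow> ('i \<Rightarrow> 'a)"
  assumes "finite K"
  shows "finite (words G K N)"
proof (rule finite_subset)
  show "words G K N \<subseteq> PiE ({..<N} \<times> K) (\<lambda>_. UNIV)"
    unfolding words_def by (intro image_subsetI restrict_PiE_iff[THEN iffD2]) auto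
qed (use assms in \<open>auto intro!: finite_PiE\<close>)

lemma card_words_pos:
  fixes G :: "('i \<Rightarrow> 'a::finite) \<Rightarrow> ('i \<Rightarrow> 'a)"
  assumes "finite K"
  shows "1 \<le> card (words G K N)"
proof -
  have "words G K N \<noteq> {}" unfolding words_def by simp
  then show ?thesis using card_gt_0_iff[of "words G K N"] finite_words[OF assms] by (simp add: Suc_le_eq)
qed

text \<open>Each configuration selects a member of \<open>U\<close> that contains its cylinder over
  \<open>K\<close>, so each word selects an itinerary through \<open>U\<close>, and the itineraries
  of all words cover the space.\<close>

lemma cover_number_le_card_words:
  fixes G :: "('i \<Rightarrow> 'a::finite) \<Rightarrow> ('i \<Rightarrow> 'a)"
  assumes "finite K" and fine: "\<And>x. \<exists>u\<in>U. {y. \<forall>z\<in>K. y z = x z} \<subseteq> u"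
  shows "cover_number (iterate_join U G N) \<le> card (words G K N)"
proof -
  obtain u where u: "\<And>x. u x \<in> U" "\<And>x. {y. \<forall>z\<in>K. y z = x z} \<subseteq> u x"
  proof -
    from fine have "\<forall>x. \<exists>u. u \<in> U \<and> {y. \<forall>z\<in>K. y z = x z} \<subseteq> u" by blast
    from choice[OF this] show ?thesis using that by blast
  qed
  \<comment> \<open>The slice of a word at time \<open>t\<close> is \<open>undefined\<close> outside
    \<open>K\<close>. This is harmless: \<open>u\<close> of a slice contains the cylinder over
    \<open>K\<close>, which depends on the values inside \<open>K\<close> only.\<close>
  let ?w = "\<lambda>p. {x. \<forall>t<N. (G ^^ t) x \<in> u (\<lambda>z. p (t, z))}"
  let ?V = "?w ` words G K N"
  have "?V \<subseteq> iterate_join U G N"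
    by (auto intro!: in_iterate_joinI u(1))
  moreover have "x \<in> \<Union>?V" for x
  proof -
    let ?p = "restrict (\<lambda>(t, z). (G ^^ t) x z) ({..<N} \<times> K)"
    have "(G ^^ t) x \<in> u (\<lambda>z. ?p (t, z))" if "t < N" for t
      using that by (intro subsetD[OF u(2)]) auto
    moreover have "?p \<in> words G K N" unfolding words_def by blast
    ultimately show ?thesis by blast
  qed
  ultimately have "cover_number (iterate_join U G N) \<le> card ?V"
    using finite_words[OF assms(1)] by (intro cover_number_le) blast+
  also have "\<dots> \<le> card (words G K N)"
    using finite_words[OF assms(1)] by (rule card_image_le)
  finally show ?thesis .
qed

text \<open>All points of one member of the iterated join share the same word, so a subcover with
  fewer members than words would miss some word.\<close>

lemma card_words_le_cover_number:
  fixes G :: "('i \<Rightarrow> 'a::finite) \<Rightarrow> ('i \<Rightarrow> 'a)"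
  assumes "finitely_covering U"
    and coarse: "\<And>u x y z. u \<in> U \<Longrightarrow> x \<in> u \<Longrightarrow> y \<in> u \<Longrightarrow> z \<in> K \<Longrightarrow> x z = y z"
  shows "card (words G K N) \<le> cover_number (iterate_join U G N)"
proof -
  obtain V where V: "V \<subseteq> iterate_join U G N" "finite V" "\<Union>V = UNIV"
      "card V = cover_number (iterate_join U G N)"
    by (rule cover_number_witness[OF finitely_covering_iterate_join[OF assms(1)]])
  let ?q = "\<lambda>x. restrict (\<lambda>(t, z). (G ^^ t) x z) ({..<N} \<times> K)"
  have const: "?q x = ?q y" if v: "v \<in> V" "x \<in> v" "y \<in> v" for v x y
  proof -
    have "v \<in> iterate_join U G N" using V(1) v(1) by auto
    then obtain u where u: "\<And>i. i < N \<Longrightarrow> u i \<in> U" "v = {x. \<forall>i<N. (G ^^ i) x \<in> u i}"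
      by (rule in_iterate_joinE) blast
    show ?thesis unfolding word_eq_iff using v u coarse by blast
  qed
  \<comment> \<open>If \<open>v\<close> is empty, \<open>SOME\<close> yields an arbitrary point;
    this only adds a value to the right-hand side, and an inclusion is all that is needed.\<close>
  have "words G K N \<subseteq> (\<lambda>v. ?q (SOME x. x \<in> v)) ` V"
  proof
    fix p assume "p \<in> words G K N"
    then obtain x where x: "p = ?q x" unfolding words_def by blast
    obtain v where v: "v \<in> V" "x \<in> v" using UnionE[OF UNIV_I[of x, folded V(3)]] .
    have "(SOME x. x \<in> v) \<in> v" using someI[of "\<lambda>x. x \<in> v", OF v(2)] .
    then show "p \<in> (\<lambda>v. ?q (SOME x. x \<in> v)) ` V" using const[OF v(1) v(2)] x v(1) by blast
  qed
  then have "card (words G K N) \<le> card V" using V(2) by (rule surj_card_le[rotated])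
  with V(4) show ?thesis by simp
qed

text \<open>Distinct members are disjoint, so this cover is a partition. For finite \<open>K\<close>
  its iterated cover numbers are word counts, which turns entropy into counting.\<close>

definition cylinders :: "'i set \<Rightarrow> ('i \<Rightarrow> 'a) set set" where
  "cylinders K = range (\<lambda>x. {y. \<forall>z\<in>K. y z = x z})"

lemma open_cylinder:
  fixes x :: "'i \<Rightarrow> 'a::discrete_topology"
  assumes "finite K"
  shows "open {y. \<forall>z\<in>K. y z = x z}"
proof -
  have "open ((\<lambda>y. y z) -` {x z})" for z
    by (intro open_vimage continuous_on_product_coordinates) (simp add: open_discrete)
  then have "open (\<Inter>z\<in>K. (\<lambda>y. y z) -` {x z})" using assms by (intro open_INT) auto
  also have "(\<Inter>z\<in>K. (\<lambda>y. y z) -` {x z}) = {y. \<forall>z\<in>K. y z = x z}" by auto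
  finally show ?thesis .
qed

lemma open_cover_cylinders:
  "finite K \<Longrightarrow> open_cover (cylinders K :: ('i \<Rightarrow> 'a::discrete_topology) set set)"
  unfolding open_cover_def cylinders_def by (auto intro: open_cylinder)

lemma finite_cylinders:
  assumes "finite K"
  shows "finite (cylinders K :: ('i \<Rightarrow> 'a::finite) set set)"
proof (rule finite_subset)
  show "(cylinders K :: ('i \<Rightarrow> 'a) set set)
      \<subseteq> (\<lambda>p. {y. \<forall>z\<in>K. y z = p z}) ` PiE K (\<lambda>_. UNIV)"
    unfolding cylinders_def
  proof clarify
    fix x :: "'i \<Rightarrow> 'a"
    show "{y. \<forall>z\<in>K. y z = x z} \<in> (\<lambda>p. {y. \<forall>z\<in>K. y z = p z}) ` PiE K (\<lambda>_. UNIV)"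
      by (rule image_eqI[of _ _ "restrict x K"]) auto
  qed
  show "finite ((\<lambda>p. {y. \<forall>z\<in>K. y z = p z}) ` PiE K (\<lambda>_. UNIV :: 'a set))"
    using assms by (intro finite_imageI finite_PiE) auto
qed

lemma finitely_covering_cylinders:
  assumes "finite K"
  shows "finitely_covering (cylinders K :: ('i \<Rightarrow> 'a::finite) set set)"
  unfolding finitely_covering_def
  by (intro exI[of _ "cylinders K"] conjI finite_cylinders assms) (auto simp: cylinders_def)

lemma cover_number_cylinders:
  fixes G :: "('i \<Rightarrow> 'a::finite) \<Rightarrow> ('i \<Rightarrow> 'a)"
  assumes "finite K"
  shows "cover_number (iterate_join (cylinders K) G N) = card (words G K N)"
proof (rule antisym)
  show "cover_number (iterate_join (cylinders K) G N) \<le> card (words G K N)"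
    by (rule cover_number_le_card_words[OF assms]) (auto simp: cylinders_def)
  show "card (words G K N) \<le> cover_number (iterate_join (cylinders K) G N)"
    by (rule card_words_le_cover_number[OF finitely_covering_cylinders[OF assms]])
      (auto simp: cylinders_def)
qed

lemma cover_entropy_cylinders_tendsto:
  fixes G :: "('i \<Rightarrow> 'a::finite) \<Rightarrow> ('i \<Rightarrow> 'a)"
  assumes "finite K"
  shows "(\<lambda>N. ln (real (card (words G K N))) / real N) \<longlonglongrightarrow> cover_entropy (cylinders K) G"
  using cover_entropy_tendsto[OF finitely_covering_cylinders[OF assms], of G]
  by (simp add: cover_number_cylinders[OF assms])

lemma cover_entropy_cylinders_nonneg:
  fixes G :: "('i \<Rightarrow> 'a::finite) \<Rightarrow> ('i \<Rightarrow> 'a)"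
  assumes "finite K"
  shows "0 \<le> cover_entropy (cylinders K) G"
proof (rule LIMSEQ_le_const[OF cover_entropy_cylinders_tendsto[OF assms]])
  have "0 \<le> ln (real (card (words G K N))) / real N" for N
    using card_words_pos[OF assms, of G N] by simp
  then show "\<exists>M. \<forall>N\<ge>M. 0 \<le> ln (real (card (words G K N))) / real N" by blast
qed

text \<open>The last hypothesis says that the cylinders over \<open>K\<close> refine
  \<open>U\<close>; the inequality of counts passes to the limit.\<close>

lemma cover_entropy_le_cylinders:
  fixes G :: "('i \<Rightarrow> 'a::finite) \<Rightarrow> ('i \<Rightarrow> 'a)"
  assumes "finite K" "finitely_covering U" "\<And>x. \<exists>u\<in>U. {y. \<forall>z\<in>K. y z = x z} \<subseteq> u"
  shows "cover_entropy U G \<le> cover_entropy (cylinders K) G"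
proof (rule LIMSEQ_le[OF cover_entropy_tendsto[OF assms(2)] cover_entropy_cylinders_tendsto[OF assms(1)]])
  have "ln (real (cover_number (iterate_join U G N))) / real N \<le> ln (real (card (words G K N))) / real N" for N
    using cover_number_le_card_words[OF assms(1,3), of G N]
      cover_number_pos[OF finitely_covering_iterate_join[OF assms(2)], of G N]
    by (intro divide_right_mono ln_mono) auto
  then show "\<exists>M. \<forall>N\<ge>M. ln (real (cover_number (iterate_join U G N))) / real N \<le> ln (real (card (words G K N))) / real N"
    by blast
qed

lemma cover_entropy_cylinders_le:
  fixes G :: "('i \<Rightarrow> 'a::finite) \<Rightarrow> ('i \<Rightarrow> 'a)"
  assumes "finite K" "finitely_covering U"
    and "\<And>u x y z. u \<in> U \<Longrightarrow> x \<in> u \<Longrightarrow> y \<in> u \<Longrightarrow> z \<in> K \<Longrightarrow> x z = y z"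
  shows "cover_entropy (cylinders K) G \<le> cover_entropy U G"
proof (rule LIMSEQ_le[OF cover_entropy_cylinders_tendsto[OF assms(1)] cover_entropy_tendsto[OF assms(2)]])
  have "ln (real (card (words G K N))) / real N \<le> ln (real (cover_number (iterate_join U G N))) / real N" for N
    using card_words_le_cover_number[of U K G N] assms(2,3) card_words_pos[OF assms(1), of G N]
    by (intro divide_right_mono ln_mono) auto
  then show "\<exists>M. \<forall>N\<ge>M. ln (real (card (words G K N))) / real N \<le> ln (real (cover_number (iterate_join U G N))) / real N"
    by blast
qed

lemma cover_entropy_cylinders_mono:
  fixes G :: "('i \<Rightarrow> 'a::finite) \<Rightarrow> ('i \<Rightarrow> 'a)"
  assumes "finite L" "K \<subseteq> L"
  shows "cover_entropy (cylinders K) G \<le> cover_entropy (cylinders L) G"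
  using assms finite_subset[OF assms(2,1)]
  by (intro cover_entropy_le_cylinders finitely_covering_cylinders) (auto simp: cylinders_def)

section \<open>Compactness of the configuration space\<close>

text \<open>Tychonoff's theorem with finite factors.\<close>

lemma compact_UNIV_configurations:
  "compact (UNIV :: ('i \<Rightarrow> 'a::{finite, discrete_topology}) set)"
proof -
  have "compact_space (product_topology (\<lambda>_::'i. euclidean :: 'a topology) UNIV)"
    unfolding compact_space_product_topology
    by (auto simp: compact_space_def intro!: finite_imp_compact)
  then show ?thesis by (simp add: euclidean_product_topology compact_space_def)
qed

text \<open>This plays the role of the Lebesgue number lemma.\<close>

lemma open_cover_finite_window:
  fixes U :: "('i \<Rightarrow> 'a::{finite, discrete_topology}) set set"
  assumes "open_cover U"
  shows "\<exists>K. finite K \<and> (\<forall>x. \<exists>u\<in>U. {y. \<forall>z\<in>K. y z = x z} \<subseteq> u)"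
proof -
  have "\<exists>K u. finite K \<and> u \<in> U \<and> {y. \<forall>z\<in>K. y z = x z} \<subseteq> u" for x :: "'i \<Rightarrow> 'a"
  proof -
    have cover: "\<Union>U = UNIV" and op: "\<And>u. u \<in> U \<Longrightarrow> open u"
      using assms by (auto simp: open_cover_def)
    obtain u where u: "u \<in> U" "x \<in> u"
      using UnionE[OF UNIV_I[of x, folded cover]] .
    with op have "open u" by simp
    then have "openin (product_topology (\<lambda>_::'i. euclidean :: 'a topology) UNIV) u"
      by (simp add: euclidean_product_topology)
    from product_topology_open_contains_basis[OF this u(2)]
    obtain X where X: "x \<in> PiE UNIV X" "finite {i. X i \<noteq> UNIV}" "PiE UNIV X \<subseteq> u"
      by auto
    \<comment> \<open>A basic open box constrains only finitely many coordinates; fixing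
      \<open>y\<close> to agree with \<open>x\<close> there keeps it inside the box.\<close>
    have "{y. \<forall>z\<in>{i. X i \<noteq> UNIV}. y z = x z} \<subseteq> u"
    proof
      fix y assume y: "y \<in> {y. \<forall>z\<in>{i. X i \<noteq> UNIV}. y z = x z}"
      have "y i \<in> X i" for i
        using y X(1) by (cases "X i = UNIV") (auto simp: PiE_iff)
      then show "y \<in> u" using X(3) by auto
    qed
    with u X show ?thesis by blast
  qed
  \<comment> \<open>The window and the member of \<open>U\<close> are packed into a pair so that a
    single use of \<open>choice\<close> selects both.\<close>
  then have "\<forall>x. \<exists>p. finite (fst p) \<and> snd p \<in> U \<and> {y. \<forall>z\<in>fst p. y z = x z} \<subseteq> snd p"
    by fastforce
  from choice[OF this] obtain p where p: "\<forall>x. finite (fst (p x)) \<and> snd (p x) \<in> U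
      \<and> {y. \<forall>z\<in>fst (p x). y z = x z} \<subseteq> snd (p x)" by blast
  define K u where "K x = fst (p x)" and "u x = snd (p x)" for x
  have Ku: "finite (K x)" "u x \<in> U" "{y. \<forall>z\<in>K x. y z = x z} \<subseteq> u x" for x
    using p unfolding K_def u_def by blast+
  have "\<exists>D\<subseteq>UNIV. finite D \<and> UNIV \<subseteq> (\<Union>x\<in>D. {y. \<forall>z\<in>K x. y z = x z})"
  proof (rule compactE_image[OF compact_UNIV_configurations])
    show "open {y. \<forall>z\<in>K x. y z = x z}" for x by (rule open_cylinder[OF Ku(1)])
  qed auto
  then obtain D where D: "finite D" "UNIV \<subseteq> (\<Union>x\<in>D. {y. \<forall>z\<in>K x. y z = x z})"
    by (elim exE conjE)
  show ?thesis
  proof (intro exI conjI allI)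
    \<comment> \<open>The union of the windows of the finite subcover works for every
      \<open>y\<close>: \<open>y\<close> lies in the cylinder of some \<open>x\<close> in
      \<open>D\<close>, and agreement with \<open>y\<close> on the union forces agreement with
      \<open>x\<close> on \<open>K x\<close>.\<close>
    show "finite (\<Union>x\<in>D. K x)" using D(1) Ku(1) by auto
    fix y
    obtain x where x: "x \<in> D" "\<forall>z\<in>K x. y z = x z" using subsetD[OF D(2) UNIV_I[of y]] by blast
    then have "{w. \<forall>z\<in>(\<Union>x\<in>D. K x). w z = y z} \<subseteq> u x" using Ku(3)[of x] by force
    then show "\<exists>u\<in>U. {w. \<forall>z\<in>(\<Union>x\<in>D. K x). w z = y z} \<subseteq> u" using Ku(2) by blast
  qed
qed

section \<open>Finite windows and the independence of rows\<close>

lemma finite_E: "finite (E n)"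
  by (rule finite_subset[of _ "{- int n..int n} \<times> {- int n..int n}"]) (auto simp: E_def)

lemma E_eq: "E n = {- int n..int n} \<times> {- int n..int n}"
  by (auto simp: E_def)

lemma finite_subset_interval:
  assumes "finite (K :: int set)"
  shows "\<exists>m. K \<subseteq> {- int m..int m}"
proof -
  have "\<bar>z\<bar> \<le> int (nat (\<Sum>z\<in>K. \<bar>z\<bar>))" if "z \<in> K" for z
    using member_le_sum[of z K abs] assms that by (simp add: sum_nonneg)
  then show ?thesis by (intro exI[of _ "nat (\<Sum>z\<in>K. \<bar>z\<bar>)"]) (force simp: abs_le_iff)
qed

lemma finite_subset_E:
  assumes "finite K"
  shows "\<exists>m. K \<subseteq> E m"
proof -
  obtain m where "fst ` K \<union> snd ` K \<subseteq> {- int m..int m}"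
    using finite_subset_interval[of "fst ` K \<union> snd ` K"] assms by auto
  then show ?thesis by (intro exI[of _ m]) (force simp: E_eq)
qed

lemma ca1_funpow_Suc:
  "(ca1 r f ^^ Suc t) x j = f (map (\<lambda>k. (ca1 r f ^^ t) x (j + k)) [- int r..int r])"
  by (simp add: ca1_def[of r f "(ca1 r f ^^ t) x"])

text \<open>The extended local map reads only the central row of its pattern, and those cells lie in
  \<open>E r\<close>, where the restriction changes nothing. Hence every row evolves on its
  own.\<close>

lemma ca_extension_funpow:
  "((ca_extension r f ^^ t) x) (i, j) = ((ca1 r f ^^ t) (\<lambda>j. x (i, j))) j"
proof (induction t arbitrary: j)
  case (Suc t)
  have "((ca_extension r f ^^ Suc t) x) (i, j)
      = f (map (\<lambda>k. ((ca_extension r f ^^ t) x) (i, j + k)) [- int r..int r])"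
    unfolding ca_extension_def ca2_def extend_block_map_def
    by (auto simp: E_def intro!: arg_cong[where f = f])
  also have "\<dots> = ((ca1 r f ^^ Suc t) (\<lambda>j. x (i, j))) j"
    by (simp only: Suc.IH ca1_funpow_Suc)
  finally show ?case .
qed simp

text \<open>A word over \<open>I \<times> J\<close> is the same as one word over \<open>J\<close>
  for each row in \<open>I\<close>. Every such family occurs, since the rows of an initial
  configuration can be prescribed independently.\<close>

lemma card_words_ca_extension:
  fixes f :: "'a::finite list \<Rightarrow> 'a"
  assumes "finite I"
  shows "card (words (ca_extension r f) (I \<times> J) N) = card (words (ca1 r f) J N) ^ card I"
proof -
  let ?W = "words (ca1 r f) J N"
  let ?q1 = "\<lambda>x. restrict (\<lambda>(t, z). (ca1 r f ^^ t) x z) ({..<N} \<times> J)"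
  let ?q2 = "\<lambda>x. restrict (\<lambda>(t, z). (ca_extension r f ^^ t) x z) ({..<N} \<times> (I \<times> J))"
  let ?g = "\<lambda>P. restrict (\<lambda>(t, i, j). P i (t, j)) ({..<N} \<times> (I \<times> J))"
  have q2: "?q2 x = ?g (restrict (\<lambda>i. ?q1 (\<lambda>j. x (i, j))) I)" for x
    by (auto simp: fun_eq_iff restrict_def ca_extension_funpow)
  have "bij_betw ?g (PiE I (\<lambda>_. ?W)) (words (ca_extension r f) (I \<times> J) N)"
    unfolding bij_betw_def
  proof
    show "inj_on ?g (PiE I (\<lambda>_. ?W))"
    proof (rule inj_onI)
      fix P Q assume P: "P \<in> PiE I (\<lambda>_. ?W)" and Q: "Q \<in> PiE I (\<lambda>_. ?W)" and eq: "?g P = ?g Q"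
      show "P = Q"
      proof (rule PiE_ext[OF P Q])
        fix i assume i: "i \<in> I"
        obtain x y where xy: "P i = ?q1 x" "Q i = ?q1 y"
          using PiE_mem[OF P i] PiE_mem[OF Q i] unfolding words_def by blast
        have "P i (t, j) = Q i (t, j)" if "t < N" "j \<in> J" for t j
          using fun_cong[OF eq, of "(t, i, j)"] that i by simp
        then have "?q1 x = ?q1 y" unfolding xy word_eq_iff by simp
        then show "P i = Q i" using xy by simp
      qed
    qed
    show "?g ` PiE I (\<lambda>_. ?W) = words (ca_extension r f) (I \<times> J) N"
    proof
      show "?g ` PiE I (\<lambda>_. ?W) \<subseteq> words (ca_extension r f) (I \<times> J) N"
      proof (rule image_subsetI)
        fix P assume P: "P \<in> PiE I (\<lambda>_. ?W)"
        then have "\<forall>i\<in>I. \<exists>x. P i = ?q1 x" unfolding words_def by blast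
        then obtain x where "\<forall>i\<in>I. P i = ?q1 (x i)" by metis
        \<comment> \<open>The redundant pairing brings the chosen rows into the exact shape of
          \<open>q2\<close> for the planar configuration assembled from them.\<close>
        then have "restrict (\<lambda>i. ?q1 (\<lambda>j. (\<lambda>(i, j). x i j) (i, j))) I = P"
          using P by (auto simp: fun_eq_iff restrict_def PiE_iff extensional_def)
        then have "?g P = ?q2 (\<lambda>(i, j). x i j)" by (simp only: q2)
        then show "?g P \<in> words (ca_extension r f) (I \<times> J) N" unfolding words_def by blast
      qed
      show "words (ca_extension r f) (I \<times> J) N \<subseteq> ?g ` PiE I (\<lambda>_. ?W)"
      proof
        fix p assume "p \<in> words (ca_extension r f) (I \<times> J) N"
        then obtain x where x: "p = ?q2 x" unfolding words_def by blast
        show "p \<in> ?g ` PiE I (\<lambda>_. ?W)"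
          unfolding x q2 by (rule imageI, rule restrict_PiE_iff[THEN iffD2]) (unfold words_def, blast)
      qed
    qed
  qed
  then have "card (words (ca_extension r f) (I \<times> J) N) = card (PiE I (\<lambda>_. ?W))"
    by (simp add: bij_betw_same_card)
  then show ?thesis using assms by (simp add: card_PiE)
qed

lemma cover_entropy_ca_extension:
  fixes f :: "'a::finite list \<Rightarrow> 'a"
  assumes "finite I" "finite J"
  shows "cover_entropy (cylinders (I \<times> J)) (ca_extension r f)
    = real (card I) * cover_entropy (cylinders J) (ca1 r f)"
proof (rule LIMSEQ_unique)
  show "(\<lambda>N. ln (real (card (words (ca_extension r f) (I \<times> J) N))) / real N)
      \<longlonglongrightarrow> cover_entropy (cylinders (I \<times> J)) (ca_extension r f)"
    using assms by (intro cover_entropy_cylinders_tendsto) auto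
  have "(\<lambda>N. real (card I) * (ln (real (card (words (ca1 r f) J N))) / real N))
      \<longlonglongrightarrow> real (card I) * cover_entropy (cylinders J) (ca1 r f)"
    using assms by (intro tendsto_intros cover_entropy_cylinders_tendsto)
  moreover have "real (card I) * (ln (real (card (words (ca1 r f) J N))) / real N)
      = ln (real (card (words (ca_extension r f) (I \<times> J) N))) / real N" for N
    using card_words_pos[OF assms(2), of "ca1 r f" N]
    by (simp add: card_words_ca_extension[OF assms(1)] ln_realpow)
  then have "(\<lambda>N. real (card I) * (ln (real (card (words (ca1 r f) J N))) / real N))
      = (\<lambda>N. ln (real (card (words (ca_extension r f) (I \<times> J) N))) / real N)" by blast
  ultimately show "(\<lambda>N. ln (real (card (words (ca_extension r f) (I \<times> J) N))) / real N)
      \<longlonglongrightarrow> real (card I) * cover_entropy (cylinders J) (ca1 r f)"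
    by simp
qed

section \<open>Determination of an interval by its ends\<close>

text \<open>Empty for \<open>r = 0\<close>, which makes the estimates below cover that case as well.\<close>

definition ends :: "nat \<Rightarrow> nat \<Rightarrow> int set" where
  "ends r n = {- int n..- int n + int r - 1} \<union> {int n - int r + 1..int n}"

text \<open>A cell of the interval outside \<open>ends r n\<close> has its whole neighbourhood of
  radius \<open>r\<close> inside the interval, so induction on time gives its next value; the end
  cells agree by assumption.\<close>

lemma ca1_determined_by_ends:
  assumes init: "\<And>z. z \<in> {- int n..int n} \<Longrightarrow> x z = y z"
    and ends: "\<And>t z. t < N \<Longrightarrow> z \<in> ends r n \<Longrightarrow> (ca1 r f ^^ t) x z = (ca1 r f ^^ t) y z"
  shows "t < N \<Longrightarrow> z \<in> {- int n..int n} \<Longrightarrow> (ca1 r f ^^ t) x z = (ca1 r f ^^ t) y z"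
proof (induction t arbitrary: z)
  case 0
  then show ?case using init by simp
next
  case (Suc t)
  show ?case
  proof (cases "z \<in> ends r n")
    case True
    then show ?thesis using ends Suc.prems by blast
  next
    case False
    then have "(ca1 r f ^^ t) x (z + k) = (ca1 r f ^^ t) y (z + k)" if "k \<in> {- int r..int r}" for k
      using Suc.prems that by (intro Suc.IH) (auto simp: ends_def)
    then show ?thesis by (auto simp del: funpow.simps simp: ca1_funpow_Suc intro!: arg_cong[where f = f])
  qed
qed

text \<open>\<open>q\<close> factors through \<open>g\<close>, whose values lie in
  \<open>P\<close>.\<close>

lemma card_range_le:
  assumes "finite P" "\<And>x. g x \<in> P" "\<And>x y. g x = g y \<Longrightarrow> q x = q y"
  shows "card (range q) \<le> card P"
proof (rule surj_card_le[OF assms(1)])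
  have "q x = q (inv g (g x))" for x
    by (rule assms(3)) (simp add: f_inv_into_f)
  then show "range q \<subseteq> (\<lambda>p. q (inv g p)) ` P" using assms(2) by blast
qed

text \<open>The initial values together with the word on the ends determine the word on the
  interval. The factor that counts initial values does not depend on \<open>N\<close>, so it
  disappears from the entropy.\<close>

lemma card_words_le_ends:
  fixes f :: "'a::finite list \<Rightarrow> 'a"
  shows "card (words (ca1 r f) {- int n..int n} N)
    \<le> card (PiE {- int n..int n} (\<lambda>_. UNIV :: 'a set)) * card (words (ca1 r f) (ends r n) N)"
proof -
  let ?K = "{- int n..int n}"
  let ?q = "\<lambda>K x. restrict (\<lambda>(t, z). (ca1 r f ^^ t) x z) ({..<N} \<times> K)"
  let ?P = "PiE ?K (\<lambda>_. UNIV :: 'a set) \<times> words (ca1 r f) (ends r n) N"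
  let ?h = "\<lambda>x. (restrict x ?K, ?q (ends r n) x)"
  have fin: "finite ?P"
    by (intro finite_cartesian_product finite_PiE finite_words) (auto simp: ends_def)
  have det: "?q ?K x = ?q ?K y" if "?h x = ?h y" for x y
  proof -
    have "x z = y z" if "z \<in> ?K" for z
      using fun_cong[OF arg_cong[OF \<open>?h x = ?h y\<close>, of fst], of z] that by simp
    moreover have "\<forall>t<N. \<forall>z\<in>ends r n. (ca1 r f ^^ t) x z = (ca1 r f ^^ t) y z"
      using that unfolding word_eq_iff[symmetric] by simp
    ultimately show ?thesis unfolding word_eq_iff
      using ca1_determined_by_ends[of n x y N r f] by blast
  qed
  have "card (words (ca1 r f) ?K N) \<le> card ?P"
    unfolding words_def[of _ ?K]
    by (rule card_range_le[OF fin, where g = ?h, OF _ det]) (auto simp: words_def)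
  then show ?thesis by (simp add: card_cartesian_product)
qed

lemma cover_entropy_le_ends:
  fixes f :: "'a::finite list \<Rightarrow> 'a"
  shows "cover_entropy (cylinders {- int n..int n}) (ca1 r f)
    \<le> cover_entropy (cylinders (ends r n)) (ca1 r f)"
proof -
  let ?K = "{- int n..int n}"
  let ?c = "card (PiE ?K (\<lambda>_. UNIV :: 'a set))"
  have fin: "finite (ends r n)" by (simp add: ends_def)
  have c: "?c \<ge> 1" by (simp add: card_PiE Suc_le_eq)
  have le: "ln (real (card (words (ca1 r f) ?K N))) / real N
      \<le> ln (real ?c) / real N + ln (real (card (words (ca1 r f) (ends r n) N))) / real N" for N
  proof -
    have "ln (real (card (words (ca1 r f) ?K N)))
        \<le> ln (real (?c * card (words (ca1 r f) (ends r n) N)))"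
      using card_words_le_ends[of r f n N] card_words_pos[of ?K "ca1 r f" N]
      by (intro ln_mono) (auto simp flip: of_nat_mult)
    also have "\<dots> = ln (real ?c) + ln (real (card (words (ca1 r f) (ends r n) N)))"
      using c card_words_pos[OF fin, of "ca1 r f" N] unfolding of_nat_mult by (intro ln_mult_pos) auto
    finally show ?thesis by (simp add: add_divide_distrib[symmetric] divide_right_mono)
  qed
  have "(\<lambda>N. ln (real ?c) / real N + ln (real (card (words (ca1 r f) (ends r n) N))) / real N)
      \<longlonglongrightarrow> 0 + cover_entropy (cylinders (ends r n)) (ca1 r f)"
    by (intro tendsto_add lim_const_over_n cover_entropy_cylinders_tendsto fin)
  then have "cover_entropy (cylinders ?K) (ca1 r f) \<le> 0 + cover_entropy (cylinders (ends r n)) (ca1 r f)"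
    using le by (intro LIMSEQ_le[OF cover_entropy_cylinders_tendsto]) auto
  then show ?thesis by simp
qed

section \<open>Frame covers compared with cylinder covers\<close>

lemma shift2_inverse: "shift2 v (shift2 (- v) x) = x"
  by (simp add: shift2_def)

lemma finitely_covering_frame_cover:
  assumes "finitely_covering C"
  shows "finitely_covering (frame_cover r n C)"
  unfolding frame_cover_def
proof (rule finitely_covering_cover_join)
  show "finite (E' r n)" by (simp add: E'_def finite_E)
  show "finitely_covering ((\<lambda>u. shift2 v ` u) ` C)" for v
    by (rule finitely_covering_image[OF assms]) (metis shift2_inverse surjI)
qed

text \<open>The cover is moved by images, so the member shifted by \<open>v\<close> tests
  \<open>shift2 (- v) y\<close>. On \<open>E m\<close> this reads \<open>y\<close> at the cells
  \<open>z - v\<close>, all of which lie in \<open>E (n + m)\<close>.\<close>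

lemma frame_cover_fine:
  assumes "\<And>x. \<exists>u\<in>C. {y. \<forall>z\<in>E m. y z = x z} \<subseteq> u"
  shows "\<exists>u\<in>frame_cover r n C. {y. \<forall>z\<in>E (n + m). y z = x z} \<subseteq> u"
proof -
  obtain u where u: "\<And>x. u x \<in> C" "\<And>x. {y. \<forall>z\<in>E m. y z = x z} \<subseteq> u x"
  proof -
    from assms have "\<forall>x. \<exists>u. u \<in> C \<and> {y. \<forall>z\<in>E m. y z = x z} \<subseteq> u" by blast
    from choice[OF this] show ?thesis using that by blast
  qed
  let ?w = "\<Inter>v\<in>E' r n. shift2 v ` u (shift2 (- v) x)"
  have "?w \<in> frame_cover r n C"
    unfolding frame_cover_def cover_join_def using u(1) by blast
  moreover have "y \<in> ?w" if y: "\<forall>z\<in>E (n + m). y z = x z" for y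
  proof
    fix v assume "v \<in> E' r n"
    then have "z - v \<in> E (n + m)" if "z \<in> E m" for z
      using that by (auto simp: E'_def E_def)
    then have "shift2 (- v) y z = shift2 (- v) x z" if "z \<in> E m" for z
      using that y by (simp add: shift2_def)
    then have "shift2 (- v) y \<in> u (shift2 (- v) x)" using u(2) by blast
    then show "y \<in> shift2 v ` u (shift2 (- v) x)" by (metis image_eqI shift2_inverse)
  qed
  ultimately show ?thesis by blast
qed

text \<open>Since images are taken, the value at \<open>z\<close> is recorded by the shift with
  \<open>v = - z\<close>; the frame is symmetric under negation, so this shift takes part in the
  join.\<close>

lemma frame_cover_coarse:
  assumes "u \<in> frame_cover r n (cylinders {(0, 0)})" "x \<in> u" "y \<in> u" "z \<in> E' r n"
  shows "x z = y z"
proof -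
  have z: "- z \<in> E' r n" using assms(4) by (auto simp: E'_def E_def)
  obtain c where c: "u = (\<Inter>v\<in>E' r n. c v)"
      "\<forall>v\<in>E' r n. c v \<in> (\<lambda>u. shift2 v ` u) ` cylinders {(0, 0)}"
    using assms(1) unfolding frame_cover_def cover_join_def by blast
  from bspec[OF c(2) z] obtain w where w: "w \<in> cylinders {(0, 0)}" "c (- z) = shift2 (- z) ` w"
    by (rule imageE)
  then have "x \<in> shift2 (- z) ` w" "y \<in> shift2 (- z) ` w"
    using assms(2,3) z unfolding c(1) by (metis INT_D)+
  with w(1) show ?thesis by (auto simp: cylinders_def shift2_def zero_prod_def)
qed

text \<open>An end cell has second coordinate of absolute value above \<open>n - r\<close>, so it
  avoids the inner square in every row. The assumption keeps \<open>n - r\<close> from truncating.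
  The product form is what \<open>cover_entropy_ca_extension\<close> requires.\<close>

lemma rows_ends_subset_frame:
  assumes "r \<le> n"
  shows "{- int n..int n} \<times> ends r n \<subseteq> E' r n"
  using assms by (auto simp: E'_def E_def ends_def)

theorem proposition19:
  fixes f :: "'a::{finite, discrete_topology} list \<Rightarrow> 'a"
    and r :: nat
    and F :: "(int \<Rightarrow> 'a) \<Rightarrow> (int \<Rightarrow> 'a)"
  assumes "F = ca1 r f"
  shows "entropy_rate r (ca_extension r f) = 2 * topological_entropy F"
proof -
  define h where "h k = cover_entropy (cylinders {- int k..int k}) F" for k
  let ?T = "topological_entropy F" and ?G = "ca_extension r f"
  have h_le_T: "ereal (h k) \<le> ?T" for k
    unfolding topological_entropy_def h_def by (intro SUP_upper) (simp add: open_cover_cylinders)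
  have h_nonneg: "0 \<le> h k" for k
    unfolding h_def by (rule cover_entropy_cylinders_nonneg) simp
  have h_mono: "h k \<le> h n" if "k \<le> n" for k n
    unfolding h_def using that by (intro cover_entropy_cylinders_mono) auto
  have upper: "cover_entropy_rate r C ?G \<le> 2 * ?T" if C: "open_cover C" for C
  proof (cases ?T)
    \<comment> \<open>Only a finite value needs work: for an infinite one the bound is trivial, and
      minus infinity is excluded by \<open>h_le_T\<close>.\<close>
    case (real t)
    obtain K where K: "finite K" "\<forall>x. \<exists>u\<in>C. {y. \<forall>z\<in>K. y z = x z} \<subseteq> u"
      using open_cover_finite_window[OF C] by (elim exE conjE)
    obtain m where m: "K \<subseteq> E m" using finite_subset_E[OF K(1)] by blast
    have fine: "\<exists>u\<in>C. {y. \<forall>z\<in>E m. y z = x z} \<subseteq> u" for x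
    proof -
      from K(2) obtain u where "u \<in> C" "{y. \<forall>z\<in>K. y z = x z} \<subseteq> u" by blast
      then show ?thesis using m by (intro bexI[of _ u]) auto
    qed
    have "cover_entropy (frame_cover r n C) ?G \<le> real (2 * (n + m) + 1) * t" for n
    proof -
      have "cover_entropy (frame_cover r n C) ?G \<le> cover_entropy (cylinders (E (n + m))) ?G"
        by (intro cover_entropy_le_cylinders finite_E finitely_covering_frame_cover
            open_cover_imp_finitely_covering compact_UNIV_configurations C frame_cover_fine fine)
      also have "\<dots> = real (2 * (n + m) + 1) * h (n + m)"
        unfolding E_eq h_def assms by (subst cover_entropy_ca_extension) auto
      also have "\<dots> \<le> real (2 * (n + m) + 1) * t"
        using h_le_T[of "n + m"] real by (intro mult_left_mono) auto
      finally show ?thesis .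
    qed
    then have "cover_entropy_rate r C ?G \<le> limsup (\<lambda>n. ereal (real (2 * (n + m) + 1) * t / real n))"
      unfolding cover_entropy_rate_def
      by (intro Limsup_mono always_eventually allI) (simp add: divide_right_mono)
    also have "\<dots> = ereal (2 * t)"
    proof (rule lim_imp_Limsup)
      have "(\<lambda>n. 2 * t + real (2 * m + 1) * t / real n) \<longlonglongrightarrow> 2 * t + 0"
        by (intro tendsto_intros lim_const_over_n)
      \<comment> \<open>The identity holds only for \<open>n > 0\<close>: at \<open>n = 0\<close>
        division by zero gives 0 on the right but leaves \<open>2 * t\<close> on the left.\<close>
      moreover have "\<forall>\<^sub>F n in sequentially.
          2 * t + real (2 * m + 1) * t / real n = real (2 * (n + m) + 1) * t / real n"
        using eventually_gt_at_top[of 0] by eventually_elim (simp add: field_simps)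
      ultimately have "(\<lambda>n. real (2 * (n + m) + 1) * t / real n) \<longlonglongrightarrow> 2 * t + 0"
        by (rule Lim_transform_eventually)
      then show "(\<lambda>n. ereal (real (2 * (n + m) + 1) * t / real n)) \<longlonglongrightarrow> ereal (2 * t)" by simp
    qed simp
    finally show ?thesis using real by simp
  qed (use h_le_T[of 0] in auto)
  have lower: "ereal (2 * h k) \<le> entropy_rate r ?G" for k
  proof -
    \<comment> \<open>The partition by the value at the origin; its frame cover records the value of
      every cell of the frame.\<close>
    let ?C = "cylinders {(0, 0)} :: (int \<times> int \<Rightarrow> 'a) set set"
    \<comment> \<open>The bound \<open>n >= r\<close> places the row ends in the frame,
      \<open>n >= k\<close> allows passing from \<open>h n\<close> to the fixed \<open>h k\<close>,
      and \<open>n >= 1\<close> permits dividing by \<open>n\<close>. The factor 2 comes from the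
      \<open>2 * n + 1\<close> rows.\<close>
    have ge: "2 * h k \<le> cover_entropy (frame_cover r n ?C) ?G / real n" if n: "n \<ge> max (max k r) 1" for n
    proof -
      have "real (2 * n + 1) * h n \<le> real (2 * n + 1) * cover_entropy (cylinders (ends r n)) F"
        unfolding h_def assms by (intro mult_left_mono cover_entropy_le_ends) auto
      also have "\<dots> = cover_entropy (cylinders ({- int n..int n} \<times> ends r n)) ?G"
        unfolding assms by (subst cover_entropy_ca_extension) (auto simp: ends_def)
      also have "\<dots> \<le> cover_entropy (frame_cover r n ?C) ?G"
      proof (rule cover_entropy_cylinders_le)
        show "finite ({- int n..int n} \<times> ends r n)" by (simp add: ends_def)
        show "finitely_covering (frame_cover r n ?C)"
          by (intro finitely_covering_frame_cover finitely_covering_cylinders) simp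
        fix u x y z
        assume "u \<in> frame_cover r n ?C" "x \<in> u" "y \<in> u" "z \<in> {- int n..int n} \<times> ends r n"
        moreover from this(4) have "z \<in> E' r n" using rows_ends_subset_frame[of r n] n by auto
        ultimately show "x z = y z" by (intro frame_cover_coarse)
      qed
      finally have "real (2 * n + 1) * h n \<le> cover_entropy (frame_cover r n ?C) ?G" .
      moreover have "2 * h k * real n \<le> real (2 * n + 1) * h n"
      proof -
        have "2 * h k * real n \<le> 2 * h n * real n"
          using h_mono[of k n] n by (intro mult_right_mono) auto
        also have "\<dots> \<le> real (2 * n + 1) * h n" using h_nonneg[of n] by (simp add: algebra_simps)
        finally show ?thesis .
      qed
      ultimately show ?thesis using n by (simp add: pos_le_divide_eq)
    qed
    have "ereal (2 * h k) \<le> liminf (\<lambda>n. ereal (cover_entropy (frame_cover r n ?C) ?G / real n))"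
      using ge by (intro Liminf_bounded eventually_sequentiallyI[of "max (max k r) 1"]) simp
    also have "\<dots> \<le> cover_entropy_rate r ?C ?G"
      unfolding cover_entropy_rate_def by (rule Liminf_le_Limsup) simp
    also have "\<dots> \<le> entropy_rate r ?G"
      unfolding entropy_rate_def
      by (intro SUP_upper) (simp add: open_cover_cylinders finite_cylinders)
    finally show ?thesis .
  qed
  \<comment> \<open>Halving the right-hand side leaves the supremum alone on the left, so each open
    cover can be treated separately.\<close>
  have T_le: "?T \<le> entropy_rate r ?G / 2"
    unfolding topological_entropy_def
  proof (intro SUP_least, clarify)
    fix U :: "(int \<Rightarrow> 'a) set set" assume U: "open_cover U"
    obtain K where K: "finite K" "\<forall>x. \<exists>u\<in>U. {y. \<forall>z\<in>K. y z = x z} \<subseteq> u"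
      using open_cover_finite_window[OF U] by (elim exE conjE)
    obtain k where k: "K \<subseteq> {- int k..int k}" using finite_subset_interval[OF K(1)] by blast
    have "cover_entropy U F \<le> cover_entropy (cylinders K) F"
      by (intro cover_entropy_le_cylinders K(1) K(2)[rule_format] open_cover_imp_finitely_covering
          compact_UNIV_configurations U)
    also have "\<dots> \<le> h k" unfolding h_def using k by (intro cover_entropy_cylinders_mono) auto
    finally have "ereal (2 * cover_entropy U F) \<le> entropy_rate r ?G"
      using lower[of k] by (meson dual_order.trans ereal_less_eq(3) mult_left_mono zero_le_numeral)
    then show "ereal (cover_entropy U F) \<le> entropy_rate r ?G / 2"
      by (cases "entropy_rate r ?G") auto
  qed
  show ?thesis
  proof (rule antisym)
    show "entropy_rate r ?G \<le> 2 * ?T"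
      unfolding entropy_rate_def using upper by (intro SUP_least) auto
    show "2 * ?T \<le> entropy_rate r ?G"
      using T_le by (cases "entropy_rate r ?G"; cases ?T) auto
  qed
qed

end
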